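(* Let $n,t\in\mathbb{N}$, let $r_1,\ldots,r_n\in\mathbb{N}$ be known, let $0<p<1$, and let $Y_1,\ldots,Y_n$ be independent random variables with $Y_i\sim\mathrm{NB}(r_i,p)$ for $i=1,\ldots,n$. Put $\mathbf{Y}=(Y_1,\ldots,Y_n)$, $T(\mathbf{Y})=\sum_{i=1}^nY_i$ and $R=r_1+r_2+\cdots+r_n$. Let $(x_1,\ldots,x_R)$ be a random sample from the conditional distribution of $(X_1,\ldots,X_R)$ given $\sum_{i=1}^R X_i=t$, where $X_1,\ldots,X_R$ are i.i.d. with $X_i\sim\mathrm{Geom}(p)$, and let $$y_1=\sum_{i=1}^{r_1}x_i,\quad y_2=\sum_{i=r_1+1}^{r_1+r_2}x_i,\quad\ldots,\quad y_n=\sum_{i=r_1+\cdots+r_{n-1}+1}^{R}x_i.$$ Then $\mathbf{y}=(y_1,\ldots,y_n)$ is a sample from the conditional distribution of $\mathbf{Y}$ given $T(\mathbf{Y})=t$.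
   Context: $\mathbb{N}=\{1,2,3,\ldots\}$. $X\sim\mathrm{Geom}(p)$ means $\mathbf{P}(X=x)=p(1-p)^x$ for $x=0,1,2,\ldots$. $Y\sim\mathrm{NB}(r,p)$ means $\mathbf{P}(Y=y)=\binom{y+r-1}{y}(1-p)^y p^r$ for $y=0,1,2,\ldots$. *)

theory Defs
  imports "HOL-Probability.Probability"
begin

definition geom_rv :: "'a measure \<Rightarrow> ('a \<Rightarrow> nat) \<Rightarrow> real \<Rightarrow> bool" where
  "geom_rv M X p \<longleftrightarrow>
     distributed M (count_space UNIV) X (\<lambda>x. ennreal (p * (1 - p) ^ x))"

text \<open>
  For \<open>r \<ge> 1\<close> the truncated subtraction in \<open>y + r - 1\<close> is the ordinary one. The explicit mass
  function is used because the library's \<open>neg_binomial_pmf\<close> is defined as the law of a sum of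
  independent geometric variables.
\<close>
definition neg_binomial_rv :: "'a measure \<Rightarrow> ('a \<Rightarrow> nat) \<Rightarrow> nat \<Rightarrow> real \<Rightarrow> bool" where
  "neg_binomial_rv M Y r p \<longleftrightarrow>
     distributed M (count_space UNIV) Y
       (\<lambda>y. ennreal (real ((y + r - 1) choose y) * (1 - p) ^ y * p ^ r))"

text \<open>
  Vectors indexed by \<open>1, \<dots>, m\<close> with entries in \<open>\<nat>\<close> are extensional functions on \<open>{1..m}\<close>.
\<close>
abbreviation vec_space :: "nat \<Rightarrow> (nat \<Rightarrow> nat) measure" where
  "vec_space m \<equiv> (\<Pi>\<^sub>M i\<in>{1..m}. count_space UNIV)"

text \<open>
  The conditional distribution of \<open>Z\<close> given the event \<open>A\<close>, i.e.
  \<open>B \<mapsto> P(A \<inter> Z\<^sup>-\<^sup>1(B)) / P(A)\<close>. If \<open>P(A) = 0\<close> this is the zero measure, from which nothing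
  is a sample in the sense below.
\<close>
definition cond_law :: "'a measure \<Rightarrow> 'b measure \<Rightarrow> ('a \<Rightarrow> 'b) \<Rightarrow> 'a set \<Rightarrow> 'b measure" where
  "cond_law M N Z A = distr (uniform_measure M A) N Z"

text \<open>\<open>x\<close>, a random element on the probability space \<open>K\<close>, is a single draw from the law \<open>D\<close>.\<close>
definition sample_from :: "'a measure \<Rightarrow> ('a \<Rightarrow> 'b) \<Rightarrow> 'b measure \<Rightarrow> bool" where
  "sample_from K x D \<longleftrightarrow> prob_space K \<and> x \<in> measurable K D \<and> distr K D x = D"

definition block_sums :: "nat \<Rightarrow> (nat \<Rightarrow> nat) \<Rightarrow> (nat \<Rightarrow> nat) \<Rightarrow> (nat \<Rightarrow> nat)" where
  "block_sums n r x =
     (\<lambda>i\<in>{1..n}. \<Sum>j = (\<Sum>k = 1..<i. r k) + 1..(\<Sum>k = 1..i. r k). x j)"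

end

theory Submission
  imports Defs
begin

text \<open>
  Conditioning on an event of the form \<open>Z \<in> B\<close> only sees the law of \<open>Z\<close>: the conditional law of
  \<open>Z\<close> is the normalised restriction of \<open>distr M N Z\<close> to \<open>B\<close> (\<open>cond_law_eq_uniform_measure\<close>). The
  blocks partition \<open>{1..R}\<close>, so the event \<open>X\<^sub>1 + \<dots> + X\<^sub>R = t\<close> says that the vector of block sums of
  \<open>X\<close> lies in \<open>B = {y. y\<^sub>1 + \<dots> + y\<^sub>n = t}\<close> (\<open>sum_block_sums\<close>), while the other conditioning event
  says that \<open>\<^bold>Y\<close> lies in the same \<open>B\<close>. It is therefore enough that the block sums of \<open>X\<close> and the
  vector \<open>\<^bold>Y\<close> have the same unconditional law.

  They do (\<open>distr_block_sums_geometric\<close>): sums over disjoint blocks of independent variables are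
  independent, and a sum of \<open>r\<^sub>i\<close> independent geometric variables is negative binomial with
  parameter \<open>r\<^sub>i\<close>, so both laws are the product of the \<open>NB(r\<^sub>i, p)\<close>. Taking block sums thus maps one
  conditional law to the other, and hence a sample to a sample (\<open>sample_from_map\<close>).
\<close>

section \<open>Geometric and negative binomial laws\<close>

lemma geom_rv_iff_distr:
  assumes "0 < p" "p \<le> 1"
  shows "geom_rv M X p \<longleftrightarrow> X \<in> measurable M (count_space UNIV) \<and>
           distr M (count_space UNIV) X = measure_pmf (geometric_pmf p)"
  using assms
  by (auto simp: geom_rv_def distributed_def measure_pmf_eq_density mult.commute)

text \<open>
  Since \<open>neg_binomial_pmf\<close> is by definition the law of a sum of independent geometric variables,
  this leaves the explicit binomial coefficients behind: from here on only sums matter.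
\<close>
lemma neg_binomial_rv_iff_distr:
  assumes "0 < p" "p \<le> 1"
  shows "neg_binomial_rv M X r p \<longleftrightarrow> X \<in> measurable M (count_space UNIV) \<and>
           distr M (count_space UNIV) X = measure_pmf (neg_binomial_pmf r p)"
  using assms
  by (auto simp: neg_binomial_rv_def distributed_def measure_pmf_eq_density pmf_neg_binomial mult_ac)

lemma (in prob_space) distr_add_indep_pmf:
  fixes X Y :: "'a \<Rightarrow> nat"
  assumes ind: "indep_var (count_space UNIV) X (count_space UNIV) Y"
    and X: "distr M (count_space UNIV) X = measure_pmf P"
    and Y: "distr M (count_space UNIV) Y = measure_pmf Q"
  shows "distr M (count_space UNIV) (\<lambda>\<omega>. X \<omega> + Y \<omega>)
           = measure_pmf (map_pmf (\<lambda>(x, y). x + y) (pair_pmf P Q))"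
proof -
  have [measurable]: "X \<in> measurable M (count_space UNIV)" "Y \<in> measurable M (count_space UNIV)"
    using ind by (auto dest: indep_var_rv1 indep_var_rv2)
  have *: "distr M (count_space UNIV) (\<lambda>\<omega>. (X \<omega>, Y \<omega>)) = measure_pmf (pair_pmf P Q)"
  proof (rule measure_eqI_countable[of _ UNIV])
    fix a :: "nat \<times> nat"
    obtain x y where a: "a = (x, y)" by (cases a)
    have "emeasure (distr M (count_space UNIV) (\<lambda>\<omega>. (X \<omega>, Y \<omega>))) {a}
          = prob ((\<lambda>\<omega>. (X \<omega>, Y \<omega>)) -` ({x} \<times> {y}) \<inter> space M)"
      by (subst emeasure_distr) (auto simp: a emeasure_eq_measure)
    also have "\<dots> = prob (X -` {x} \<inter> space M) * prob (Y -` {y} \<inter> space M)"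
      by (subst indep_varD[OF ind]) auto
    also have "prob (X -` {x} \<inter> space M) = pmf P x"
      by (subst measure_distr[symmetric, where N = "count_space UNIV"]) (auto simp: X pmf.rep_eq)
    also have "prob (Y -` {y} \<inter> space M) = pmf Q y"
      by (subst measure_distr[symmetric, where N = "count_space UNIV"]) (auto simp: Y pmf.rep_eq)
    finally show "emeasure (distr M (count_space UNIV) (\<lambda>\<omega>. (X \<omega>, Y \<omega>))) {a}
                    = emeasure (measure_pmf (pair_pmf P Q)) {a}"
      by (simp add: a pmf_pair emeasure_pmf_single)
  qed auto
  have "distr M (count_space UNIV) (\<lambda>\<omega>. X \<omega> + Y \<omega>)
        = distr (distr M (count_space UNIV) (\<lambda>\<omega>. (X \<omega>, Y \<omega>))) (count_space UNIV) (\<lambda>(x, y). x + y)"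
    by (subst distr_distr) (auto simp: comp_def)
  then show ?thesis
    by (simp add: * map_pmf_rep_eq)
qed

text \<open>
  The recursion defining \<open>neg_binomial_pmf\<close> adds one independent geometric variable at a time, so
  induction over \<open>J\<close> only has to split off one variable that is independent of the sum of the rest.
\<close>
lemma (in prob_space) distr_sum_indep_geometric:
  fixes X :: "'i \<Rightarrow> 'a \<Rightarrow> nat"
  assumes "finite J"
    and "indep_vars (\<lambda>_. count_space UNIV) X J"
    and "\<And>j. j \<in> J \<Longrightarrow> distr M (count_space UNIV) (X j) = measure_pmf (geometric_pmf p)"
  shows "distr M (count_space UNIV) (\<lambda>\<omega>. \<Sum>j\<in>J. X j \<omega>)
           = measure_pmf (neg_binomial_pmf (card J) p)"
  using assms
proof (induction J rule: finite_induct)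
  case empty
  show ?case
    by (rule measure_eqI_countable[of _ UNIV])
       (auto simp: emeasure_distr emeasure_space_1 indicator_def)
next
  case (insert i J)
  have "indep_var (PiM {i} (\<lambda>_. count_space UNIV)) (\<lambda>\<omega>. restrict (\<lambda>i. X i \<omega>) {i})
                  (PiM J (\<lambda>_. count_space UNIV)) (\<lambda>\<omega>. restrict (\<lambda>i. X i \<omega>) J)"
    by (rule indep_var_restrict[OF insert.prems(1)]) (use insert.hyps in auto)
  then have "indep_var (count_space UNIV) ((\<lambda>f. f i) \<circ> (\<lambda>\<omega>. restrict (\<lambda>i. X i \<omega>) {i}))
               (count_space UNIV) ((\<lambda>f. \<Sum>j\<in>J. f j) \<circ> (\<lambda>\<omega>. restrict (\<lambda>i. X i \<omega>) J))"
    by (rule indep_var_compose)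
       (use insert.hyps in \<open>auto simp: count_space_PiM_finite\<close>)
  then have "indep_var (count_space UNIV) (X i) (count_space UNIV) (\<lambda>\<omega>. \<Sum>j\<in>J. X j \<omega>)"
    by (simp add: comp_def)
  moreover have "indep_vars (\<lambda>_. count_space UNIV) X J"
    by (rule indep_vars_subset[OF insert.prems(1)]) auto
  ultimately show ?case
    using insert by (simp add: distr_add_indep_pmf neg_binomial_pmf_Suc)
qed

section \<open>Conditional laws under maps\<close>

text \<open>
  This is what makes the probability space irrelevant: two random elements with equal laws, even on
  different spaces, have equal conditional laws given that they lie in \<open>B\<close>. It includes the
  degenerate case of probability zero, where both sides vanish.
\<close>
lemma cond_law_eq_uniform_measure:
  assumes Z: "Z \<in> measurable M N" and B: "B \<in> sets N"
  shows "cond_law M N Z (Z -` B \<inter> space M) = uniform_measure (distr M N Z) B"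
proof (rule measure_eqI)
  fix C assume "C \<in> sets (cond_law M N Z (Z -` B \<inter> space M))"
  then have C: "C \<in> sets N" by (simp add: cond_law_def)
  have "(Z -` B \<inter> space M) \<inter> (Z -` C \<inter> space M) = Z -` (B \<inter> C) \<inter> space M" by auto
  then show "emeasure (cond_law M N Z (Z -` B \<inter> space M)) C = emeasure (uniform_measure (distr M N Z) B) C"
    using Z B C by (simp add: cond_law_def emeasure_distr measurable_sets)
qed (simp add: cond_law_def)

lemma distr_cond_law:
  assumes "Z \<in> measurable M N" "S \<in> measurable N N'"
  shows "distr (cond_law M N Z A) N' S = cond_law M N' (S \<circ> Z) A"
  using assms unfolding cond_law_def by (subst distr_distr) auto

lemma sample_from_map:
  assumes x: "sample_from K x D" and f: "f \<in> measurable D D'" and D': "distr D D' f = D'"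
  shows "sample_from K (\<lambda>\<omega>. f (x \<omega>)) D'"
proof -
  have "distr (distr K D x) D' f = distr K D' (f \<circ> x)"
    using x f by (intro distr_distr) (auto simp: sample_from_def)
  then show ?thesis
    using x f D' by (auto simp: sample_from_def comp_def)
qed

section \<open>Blocks of consecutive indices\<close>

definition block :: "(nat \<Rightarrow> nat) \<Rightarrow> nat \<Rightarrow> nat set" where
  "block r i = {(\<Sum>k = 1..<i. r k) + 1..(\<Sum>k = 1..i. r k)}"

lemma block_sums_eq: "block_sums n r x = (\<lambda>i\<in>{1..n}. \<Sum>j\<in>block r i. x j)"
  by (simp add: block_sums_def block_def)

lemma sum_split_last:
  fixes r :: "nat \<Rightarrow> nat"
  assumes "1 \<le> i"
  shows "(\<Sum>k = 1..i. r k) = (\<Sum>k = 1..<i. r k) + r i"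
  using assms by (simp add: sum.last_plus)

lemma card_block: "1 \<le> i \<Longrightarrow> card (block r i) = r i"
  by (simp add: block_def sum_split_last del: One_nat_def)

lemma disjoint_blocks: "disjoint_family_on (block r) {1..n}"
proof -
  have "block r i \<inter> block r j = {}" if "i < j" for i j
  proof -
    have "(\<Sum>k = 1..i. r k) \<le> (\<Sum>k = 1..<j. r k)"
      using that by (intro sum_mono2) auto
    then show ?thesis by (auto simp: block_def)
  qed
  then show ?thesis
    unfolding disjoint_family_on_def by (metis Int_commute nat_neq_iff)
qed

lemma UN_blocks: "(\<Union>i\<in>{1..n}. block r i) = {1..\<Sum>i = 1..n. r i}"
proof (induction n)
  case (Suc n)
  have "{1..Suc n} = insert (Suc n) {1..n}" by auto
  moreover have "block r (Suc n) = {(\<Sum>i = 1..n. r i) + 1..(\<Sum>i = 1..n. r i) + r (Suc n)}"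
    by (simp add: block_def atLeastLessThanSuc_atLeastAtMost)
  ultimately show ?case using Suc by auto
qed simp

lemma sum_block_sums:
  "(\<Sum>i = 1..n. block_sums n r x i) = (\<Sum>j = 1..(\<Sum>i = 1..n. r i). x j)"
proof -
  have "(\<Sum>j\<in>(\<Union>i\<in>{1..n}. block r i). x j) = (\<Sum>i = 1..n. \<Sum>j\<in>block r i. x j)"
    using disjoint_blocks[of r n]
    by (intro sum.UNION_disjoint) (auto simp: block_def disjoint_family_on_def)
  then show ?thesis by (simp add: UN_blocks block_sums_eq del: One_nat_def)
qed

text \<open>
  Finitely many coordinates in a countable set carry the discrete \<open>\<sigma>\<close>-algebra, which makes every
  map and set of vectors below measurable.
\<close>
lemma vec_space_eq_count_space:
  "vec_space m = count_space ({1..m} \<rightarrow>\<^sub>E UNIV)"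
  by (rule count_space_PiM_finite) auto

lemma block_sums_measurable: "block_sums n r \<in> measurable (vec_space R) (vec_space n)"
  unfolding vec_space_eq_count_space by (simp add: block_sums_def del: One_nat_def)

section \<open>The law of the block sums\<close>

lemma (in prob_space) distr_vec_eq_PiM:
  fixes Y :: "nat \<Rightarrow> 'a \<Rightarrow> nat"
  assumes "1 \<le> n" "indep_vars (\<lambda>_. count_space UNIV) Y {1..n}"
  shows "distr M (vec_space n) (\<lambda>\<omega>. \<lambda>i\<in>{1..n}. Y i \<omega>)
           = (\<Pi>\<^sub>M i\<in>{1..n}. distr M (count_space UNIV) (Y i))"
  using assms
  by (subst indep_vars_iff_distr_eq_PiM'[symmetric]) (auto simp: indep_vars_def)

text \<open>
  Disjoint blocks of an independent family are independent, so the law of the vector of block sums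
  is determined by its marginals, and these are negative binomial because block \<open>i\<close> has \<open>r i\<close>
  elements.
\<close>
lemma (in prob_space) distr_block_sums_geometric:
  fixes X :: "nat \<Rightarrow> 'a \<Rightarrow> nat"
  assumes n: "1 \<le> n" and R: "R = (\<Sum>i = 1..n. r i)"
    and ind: "indep_vars (\<lambda>_. count_space UNIV) X {1..R}"
    and X: "\<And>j. j \<in> {1..R} \<Longrightarrow>
              distr M (count_space UNIV) (X j) = measure_pmf (geometric_pmf p)"
  shows "distr M (vec_space n) (block_sums n r \<circ> (\<lambda>\<omega>. \<lambda>j\<in>{1..R}. X j \<omega>))
           = (\<Pi>\<^sub>M i\<in>{1..n}. measure_pmf (neg_binomial_pmf (r i) p))"
proof -
  define S where "S = (\<lambda>i \<omega>. \<Sum>j\<in>block r i. X j \<omega>)"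
  have sub: "block r i \<subseteq> {1..R}" if "i \<in> {1..n}" for i
    using that UN_blocks[of r n] R by blast
  have "indep_vars (\<lambda>i. PiM (block r i) (\<lambda>_. count_space UNIV))
          (\<lambda>i \<omega>. restrict (\<lambda>j. X j \<omega>) (block r i)) {1..n}"
    by (rule indep_vars_restrict[OF ind sub disjoint_blocks])
  then have "indep_vars (\<lambda>_. count_space UNIV)
      (\<lambda>i \<omega>. \<Sum>j\<in>block r i. restrict (\<lambda>j. X j \<omega>) (block r i) j) {1..n}"
    by (rule indep_vars_compose2[where Y = "\<lambda>i f. \<Sum>j\<in>block r i. f j"])
       (simp add: count_space_PiM_finite block_def)
  then have S: "indep_vars (\<lambda>_. count_space UNIV) S {1..n}"
    by (simp add: S_def)
  have marginal: "distr M (count_space UNIV) (S i) = measure_pmf (neg_binomial_pmf (r i) p)"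
    if i: "i \<in> {1..n}" for i
  proof -
    have "distr M (count_space UNIV) (S i) = measure_pmf (neg_binomial_pmf (card (block r i)) p)"
      unfolding S_def
    proof (rule distr_sum_indep_geometric)
      show "finite (block r i)" by (simp add: block_def)
      show "indep_vars (\<lambda>_. count_space UNIV) X (block r i)"
        by (rule indep_vars_subset[OF ind sub[OF i]])
      show "distr M (count_space UNIV) (X j) = measure_pmf (geometric_pmf p)"
        if "j \<in> block r i" for j
        using that sub[OF i] by (intro X) auto
    qed
    then show ?thesis using i by (simp add: card_block)
  qed
  have "block_sums n r \<circ> (\<lambda>\<omega>. \<lambda>j\<in>{1..R}. X j \<omega>) = (\<lambda>\<omega>. \<lambda>i\<in>{1..n}. S i \<omega>)"
  proof -
    have "(\<Sum>j\<in>block r i. restrict (\<lambda>j. X j \<omega>) {1..R} j) = S i \<omega>" if "i \<in> {1..n}" for i \<omega>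
      unfolding S_def using sub[OF that] by (intro sum.cong) auto
    then show ?thesis
      by (auto simp: fun_eq_iff block_sums_eq restrict_def)
  qed
  then have "distr M (vec_space n) (block_sums n r \<circ> (\<lambda>\<omega>. \<lambda>j\<in>{1..R}. X j \<omega>))
      = (\<Pi>\<^sub>M i\<in>{1..n}. distr M (count_space UNIV) (S i))"
    using distr_vec_eq_PiM[OF n S] by (simp only:)
  also have "\<dots> = (\<Pi>\<^sub>M i\<in>{1..n}. measure_pmf (neg_binomial_pmf (r i) p))"
    by (rule PiM_cong) (simp_all only: marginal)
  finally show ?thesis .
qed

section \<open>Sampling from the conditional law\<close>

theorem mainTheorem4:
  fixes n t R :: nat and r :: "nat \<Rightarrow> nat" and p :: real
    and M :: "'a measure" and Y :: "nat \<Rightarrow> 'a \<Rightarrow> nat"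
    and N :: "'b measure" and X :: "nat \<Rightarrow> 'b \<Rightarrow> nat"
    and K :: "'c measure" and x :: "'c \<Rightarrow> nat \<Rightarrow> nat"
  assumes "1 \<le> n" and "1 \<le> t"
    and "\<And>i. i \<in> {1..n} \<Longrightarrow> 1 \<le> r i"
    and "0 < p" and "p < 1"
    and "prob_space M"
    and "prob_space.indep_vars M (\<lambda>_. count_space UNIV) Y {1..n}"
    and "\<And>i. i \<in> {1..n} \<Longrightarrow> neg_binomial_rv M (Y i) (r i) p"
    and "R = (\<Sum>i = 1..n. r i)"
    and "prob_space N"
    and "prob_space.indep_vars N (\<lambda>_. count_space UNIV) X {1..R}"
    and "\<And>j. j \<in> {1..R} \<Longrightarrow> geom_rv N (X j) p"
    and "sample_from K x
           (cond_law N (vec_space R) (\<lambda>\<omega>. \<lambda>j\<in>{1..R}. X j \<omega>)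
              {\<omega> \<in> space N. (\<Sum>j = 1..R. X j \<omega>) = t})"
  shows "sample_from K (\<lambda>\<omega>. block_sums n r (x \<omega>))
           (cond_law M (vec_space n) (\<lambda>\<omega>. \<lambda>i\<in>{1..n}. Y i \<omega>)
              {\<omega> \<in> space M. (\<Sum>i = 1..n. Y i \<omega>) = t})"
proof -
  interpret M: prob_space M by fact
  interpret N: prob_space N by fact
  let ?Xvec = "\<lambda>\<omega>. \<lambda>j\<in>{1..R}. X j \<omega>" and ?Yvec = "\<lambda>\<omega>. \<lambda>i\<in>{1..n}. Y i \<omega>"
  let ?S = "block_sums n r"
  define B where "B = {y \<in> space (vec_space n). (\<Sum>i = 1..n. y i) = t}"
  let ?A = "{\<omega> \<in> space N. (\<Sum>j = 1..R. X j \<omega>) = t}"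
  let ?D = "cond_law N (vec_space R) ?Xvec ?A"
  have p: "0 < p" "p \<le> 1" using assms(4,5) by auto
  have B: "B \<in> sets (vec_space n)"
    unfolding B_def vec_space_eq_count_space by auto
  have Y: "Y i \<in> measurable M (count_space UNIV)"
      "distr M (count_space UNIV) (Y i) = measure_pmf (neg_binomial_pmf (r i) p)"
    if "i \<in> {1..n}" for i
    using assms(8)[OF that] neg_binomial_rv_iff_distr[OF p] by auto
  have X: "X j \<in> measurable N (count_space UNIV)"
      "distr N (count_space UNIV) (X j) = measure_pmf (geometric_pmf p)"
    if "j \<in> {1..R}" for j
    using assms(12)[OF that] geom_rv_iff_distr[OF p] by auto
  have Yvec: "?Yvec \<in> measurable M (vec_space n)"
    using Y(1) by (intro measurable_restrict) auto
  have Xvec: "?Xvec \<in> measurable N (vec_space R)"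
    using X(1) by (intro measurable_restrict) auto
  have "distr N (vec_space n) (?S \<circ> ?Xvec)
      = (\<Pi>\<^sub>M i\<in>{1..n}. measure_pmf (neg_binomial_pmf (r i) p))"
    by (rule N.distr_block_sums_geometric[OF assms(1,9,11) X(2)])
  also have "\<dots> = (\<Pi>\<^sub>M i\<in>{1..n}. distr M (count_space UNIV) (Y i))"
    by (rule PiM_cong) (simp_all only: Y(2))
  also have "\<dots> = distr M (vec_space n) ?Yvec"
    by (rule M.distr_vec_eq_PiM[OF assms(1,7), symmetric])
  finally have same_law: "distr N (vec_space n) (?S \<circ> ?Xvec) = distr M (vec_space n) ?Yvec" .
  have A_vimage: "?A = (?S \<circ> ?Xvec) -` B \<inter> space N"
  proof -
    have "?S (?Xvec \<omega>) \<in> space (vec_space n)" for \<omega>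
      by (simp add: block_sums_def space_PiM)
    moreover have "(\<Sum>i = 1..n. ?S (?Xvec \<omega>) i) = (\<Sum>j = 1..R. X j \<omega>)" for \<omega>
      unfolding sum_block_sums assms(9)[symmetric] by simp
    ultimately show ?thesis
      by (auto simp: B_def simp del: One_nat_def)
  qed
  have Y_vimage: "{\<omega> \<in> space M. (\<Sum>i = 1..n. Y i \<omega>) = t} = ?Yvec -` B \<inter> space M"
    by (auto simp: B_def space_PiM)
  have "distr ?D (vec_space n) ?S = cond_law N (vec_space n) (?S \<circ> ?Xvec) ?A"
    by (rule distr_cond_law[OF Xvec block_sums_measurable])
  also have "\<dots> = uniform_measure (distr N (vec_space n) (?S \<circ> ?Xvec)) B"
    unfolding A_vimage
    by (rule cond_law_eq_uniform_measure[OF measurable_comp[OF Xvec block_sums_measurable] B])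
  also have "\<dots> = cond_law M (vec_space n) ?Yvec (?Yvec -` B \<inter> space M)"
    unfolding same_law by (rule cond_law_eq_uniform_measure[OF Yvec B, symmetric])
  finally have push: "distr ?D (vec_space n) ?S
      = cond_law M (vec_space n) ?Yvec {\<omega> \<in> space M. (\<Sum>i = 1..n. Y i \<omega>) = t}"
    (is "_ = ?E") unfolding Y_vimage .
  have E: "sets ?E = sets (vec_space n)" and D: "sets ?D = sets (vec_space R)"
    by (simp_all add: cond_law_def)
  show ?thesis
  proof (rule sample_from_map[OF assms(13)])
    show "?S \<in> measurable ?D ?E"
      unfolding measurable_cong_sets[OF D E] by (rule block_sums_measurable)
    show "distr ?D ?E ?S = ?E"
      unfolding distr_cong[OF refl E refl] by (rule push)
  qed
qed

end
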